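(* For every graph $H$ (connected, with at least three nodes, of constant size) that is not a clique and every $r \geq 1$, the $r$-round bandwidth complexity of $\textsc{MemList}(H)$ under node insertions is $\Omega(n/r)$.
   Context: Dynamic network model: a sequence of graphs $G^0, G^1, \ldots$ with $n$ nodes in total, each obtained from the previous by at most one node insertion (a new node adjacent to an arbitrary subset of existing nodes); nodes have distinct IDs from $[n]$, know their neighbors' IDs and initially the whole of $G^0$; communication is synchronous, each round the change happens first, then each node sends a $B$-bit message to each neighbor; nodes detect changes only via their neighbor lists; algorithms are deterministic. An $r$-round algorithm works under the promise that each change at round $i$ is followed by $r-1$ change-free rounds and must output correctly for $G^i$ by the end of round $i+r-1$. The $r$-round bandwidth complexity is the minimum such $B$. $\textsc{MemList}(H)$: each node $v$ lists all subgraphs isomorphic to $H$ containing $v$. *)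

theory Defs
  imports "Graph_Theory.Graph_Theory"
begin

text \<open>
  Simple undirected graphs are the symmetric, loop-free, finite pair digraphs
  (locale \<^locale>\<open>pair_graph\<close>). Network nodes are identified with their IDs.
\<close>

type_synonym network = "nat pair_pre_digraph"

definition neighbors :: "'a pair_pre_digraph \<Rightarrow> 'a \<Rightarrow> 'a set" where
  "neighbors G v = {u. (v, u) \<in> parcs G}"

section \<open>Dynamic networks under node insertions\<close>

definition node_insertion :: "'a pair_pre_digraph \<Rightarrow> 'a pair_pre_digraph \<Rightarrow> bool" where
  "node_insertion G G' \<longleftrightarrow>
    (\<exists>v S. v \<notin> pverts G \<and> S \<subseteq> pverts G \<and>
      G' = \<lparr> pverts = insert v (pverts G), parcs = parcs G \<union> {v} \<times> S \<union> S \<times> {v} \<rparr>)"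

text \<open>\<open>G i\<close> is the graph of round \<open>i\<close>; the nodes occurring over all time are exactly \<open>1, \<dots>, n\<close>.\<close>

definition dynamic_network :: "nat \<Rightarrow> (nat \<Rightarrow> network) \<Rightarrow> bool" where
  "dynamic_network n G \<longleftrightarrow>
    pair_graph (G 0) \<and>
    (\<forall>i. G (Suc i) = G i \<or> node_insertion (G i) (G (Suc i))) \<and>
    (\<Union>i. pverts (G i)) = {1..n}"

definition change_at :: "(nat \<Rightarrow> network) \<Rightarrow> nat \<Rightarrow> bool" where
  "change_at G i \<longleftrightarrow> i \<ge> 1 \<and> G i \<noteq> G (i - 1)"

definition change_promise :: "nat \<Rightarrow> (nat \<Rightarrow> network) \<Rightarrow> bool" where
  "change_promise r G \<longleftrightarrow>
    (\<forall>i. change_at G i \<longrightarrow> (\<forall>j. i < j \<and> j \<le> i + r - 1 \<longrightarrow> \<not> change_at G j))"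

section \<open>Deterministic distributed algorithms\<close>

text \<open>
  An observation is what a node sees in one round: the messages received, indexed by the
  sending neighbors. Its domain is the node's neighbor list in that round.
\<close>

type_synonym message = "bool list"
type_synonym observation = "nat \<rightharpoonup> message"

text \<open>
  Everything a node knows: its ID, the initial graph, the number of the current round, and
  its observations in the rounds completed since it joined. Nodes inserted later also know
  the initial graph and the global round number. Computation is unrestricted, so the full
  history serves as the local state.
\<close>

record view =
  node_id :: nat
  initial_graph :: network
  round_no :: nat
  history :: "observation list"

text \<open>
  \<open>send A w N u\<close> is the message to neighbor \<open>u\<close> from a node with view \<open>w\<close> and current
  neighbor list \<open>N\<close>.
\<close>

record 'out algorithm =
  send :: "view \<Rightarrow> nat set \<Rightarrow> nat \<Rightarrow> message"
  result :: "view \<Rightarrow> 'out"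

definition has_bandwidth :: "'out algorithm \<Rightarrow> nat \<Rightarrow> bool" where
  "has_bandwidth A B \<longleftrightarrow> (\<forall>w N u. length (send A w N u) = B)"

text \<open>
  \<open>run_history A G t v\<close> is the history of \<open>v\<close> at the end of round \<open>t\<close>. Rounds are numbered
  from \<open>1\<close>; in round \<open>Suc t\<close> the graph first becomes \<open>G (Suc t)\<close>, and then all messages are
  exchanged along its edges. The history is empty as long as \<open>v\<close> is absent.
\<close>

fun run_history :: "'out algorithm \<Rightarrow> (nat \<Rightarrow> network) \<Rightarrow> nat \<Rightarrow> nat \<Rightarrow> observation list" where
  "run_history A G 0 v = []"
| "run_history A G (Suc t) v =
    (if v \<in> pverts (G (Suc t)) then
       run_history A G t v @
         [\<lambda>u. if u \<in> neighbors (G (Suc t)) v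
              then Some (send A
                     \<lparr> node_id = u, initial_graph = G 0, round_no = Suc t,
                       history = run_history A G t u \<rparr>
                     (neighbors (G (Suc t)) u) v)
              else None]
     else [])"

definition run_result :: "'out algorithm \<Rightarrow> (nat \<Rightarrow> network) \<Rightarrow> nat \<Rightarrow> nat \<Rightarrow> 'out" where
  "run_result A G t v =
    result A \<lparr> node_id = v, initial_graph = G 0, round_no = t, history = run_history A G t v \<rparr>"

section \<open>Bandwidth complexity\<close>

text \<open>A problem \<open>P\<close> prescribes the output \<open>P G v\<close> of each node \<open>v\<close> of the network \<open>G\<close>.\<close>

definition solves :: "nat \<Rightarrow> nat \<Rightarrow> (network \<Rightarrow> nat \<Rightarrow> 'out) \<Rightarrow> 'out algorithm \<Rightarrow> bool" where
  "solves n r P A \<longleftrightarrow>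
    (\<forall>G. dynamic_network n G \<and> change_promise r G \<longrightarrow>
      (\<forall>i. change_at G i \<longrightarrow>
        (\<forall>v \<in> pverts (G i). run_result A G (i + r - 1) v = P (G i) v)))"

text \<open>
  The algorithm may depend on \<open>n\<close>, \<open>r\<close> and \<open>B\<close>. The value is \<open>\<infinity>\<close> if no bandwidth suffices,
  which happens when \<open>r\<close> is too small for information to travel as far as \<open>P\<close> needs.
\<close>

definition bandwidth_complexity :: "nat \<Rightarrow> nat \<Rightarrow> (network \<Rightarrow> nat \<Rightarrow> 'out) \<Rightarrow> enat" where
  "bandwidth_complexity n r P =
    (INF B \<in> {B. \<exists>A :: 'out algorithm. has_bandwidth A B \<and> solves n r P A}. enat B)"

section \<open>Membership listing\<close>

text \<open>
  Subgraphs are not required to be induced. Being isomorphic to a symmetric, loop-free \<open>H\<close>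
  makes \<open>K\<close> symmetric and loop-free as well.
\<close>

definition mem_list :: "'a pair_pre_digraph \<Rightarrow> network \<Rightarrow> nat \<Rightarrow> network set" where
  "mem_list H G v =
    {K. subgraph (with_proj K) (with_proj G) \<and> v \<in> pverts K \<and>
        digraph_iso (with_proj K) (with_proj H)}"

end

theory Submission
  imports Defs
begin

text \<open>
  Choose distinct non-adjacent nodes \<open>u\<close> and \<open>w\<close> of \<open>H\<close>. Start with a copy of \<open>H - {u, w}\<close> and
  insert a linear number of nodes one after the other, each of which is either isolated or
  attached to the copy as \<open>w\<close> is in \<open>H\<close>. Finally insert a node \<open>x\<close> attached as \<open>u\<close> is. Since \<open>u\<close>
  and \<open>w\<close> are not adjacent, the neighborhood of \<open>x\<close> does not depend on the choices made before.
  As \<open>H\<close> has no isolated nodes, a candidate lies in a copy of \<open>H\<close> through \<open>x\<close> iff it is attached,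
  so \<open>x\<close> has to reconstruct all the choices from at most \<open>r * B * card (pverts H)\<close> received bits.
\<close>

section \<open>Counting partial maps; arcs and isomorphisms of pair digraphs\<close>

text \<open>Such maps are the observations that a node with neighbor list \<open>N\<close> can make
  in one round. They embed into the extensional functions on \<open>N\<close>.\<close>

lemma card_partial_functions_le:
  assumes "finite N" "finite Y"
  shows "finite {m :: 'b \<rightharpoonup> 'c. dom m = N \<and> ran m \<subseteq> Y}"
    and "card {m :: 'b \<rightharpoonup> 'c. dom m = N \<and> ran m \<subseteq> Y} \<le> card Y ^ card N"
proof -
  let ?M = "{m :: 'b \<rightharpoonup> 'c. dom m = N \<and> ran m \<subseteq> Y}"
  let ?f = "\<lambda>m :: 'b \<rightharpoonup> 'c. restrict (\<lambda>x. the (m x)) N"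
  have inj: "inj_on ?f ?M"
  proof (rule inj_onI)
    fix m m' assume m: "m \<in> ?M" "m' \<in> ?M" and eq: "?f m = ?f m'"
    show "m = m'"
    proof
      fix x
      show "m x = m' x"
      proof (cases "x \<in> N")
        case True
        then have "the (m x) = the (m' x)" using fun_cong[OF eq, of x] by simp
        moreover have "x \<in> dom m" "x \<in> dom m'" using m True by auto
        ultimately show ?thesis by (auto simp: dom_def)
      next
        case False
        then have "x \<notin> dom m" "x \<notin> dom m'" using m by auto
        then show ?thesis by (simp add: dom_def)
      qed
    qed
  qed
  have sub: "?f ` ?M \<subseteq> N \<rightarrow>\<^sub>E Y"
    by (force simp: PiE_iff ran_def dom_def)
  have fin: "finite (N \<rightarrow>\<^sub>E Y)"
    using assms by (intro finite_PiE) auto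
  show "finite ?M" using inj_on_finite[OF inj sub fin] .
  show "card ?M \<le> card Y ^ card N"
    using card_inj_on_le[OF inj sub fin] assms by (simp add: card_funcsetE)
qed

text \<open>Connectedness of a symmetric graph yields a walk from \<open>p\<close> to some other
  node, and its first arc leaves \<open>p\<close>.\<close>

lemma pair_graph_connected_imp_arc:
  assumes "pair_graph H" "Digraph_Component.connected (with_proj H)" "card (pverts H) \<ge> 2" "p \<in> pverts H"
  shows "\<exists>q. (p, q) \<in> parcs H"
proof -
  interpret pair_graph H by fact
  have "\<not> pverts H \<subseteq> {p}"
    using assms(3) card_mono[of "{p}" "pverts H"] by auto
  then obtain q where q: "q \<in> pverts H" "q \<noteq> p" by auto
  have "strongly_connected (with_proj H)"
    using symmetric_connected_imp_strongly_connected pair_sym_arcs assms(2) by simp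
  then have "p \<rightarrow>\<^sup>*\<^bsub>with_proj H\<^esub> q" using assms(4) q by (auto elim!: strongly_connectedE)
  then show ?thesis using q
    by (cases rule: converse_reachable_cases) auto
qed

text \<open>Isomorphisms commute with tails, so an arc leaving the image of \<open>i\<close> comes
  from an arc whose tail has the same image as \<open>i\<close>; injectivity makes that tail
  \<open>i\<close> itself.\<close>

lemma digraph_iso_with_proj_arc:
  assumes iso: "digraph_iso (with_proj K) (with_proj H)"
    and H: "\<And>p. p \<in> pverts H \<Longrightarrow> \<exists>q. (p, q) \<in> parcs H"
    and i: "i \<in> pverts K"
  shows "\<exists>j. (i, j) \<in> parcs K"
proof -
  from iso obtain f where f: "pre_digraph.digraph_isomorphism (with_proj K) f"
    and eq: "with_proj H = app_iso f (with_proj K)"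
    by (auto simp: digraph_iso_def)
  note f' = f[unfolded pre_digraph.digraph_isomorphism_def]
  have V: "pverts H = iso_verts f ` pverts K" and A: "parcs H = iso_arcs f ` parcs K"
    and T: "fst = iso_tail f"
    using arg_cong[OF eq, of verts] arg_cong[OF eq, of arcs] arg_cong[OF eq, of tail] by simp_all
  obtain q where "(iso_verts f i, q) \<in> parcs H" using H[of "iso_verts f i"] V i by auto
  then obtain a where a: "a \<in> parcs K" "iso_arcs f a = (iso_verts f i, q)" using A by auto
  have "iso_verts f (fst a) = iso_verts f i"
    using f' a T[symmetric] by auto
  moreover have "fst a \<in> pverts K"
    using f' a(1) wf_digraph.tail_in_verts[of "with_proj K" a] by auto
  ultimately have "fst a = i" using f' i by (auto dest: inj_onD)
  then show ?thesis using a(1) by (cases a) auto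
qed

lemma digraph_iso_with_projI:
  assumes "pair_wf_digraph K" and bij: "bij_betw f (pverts K) (pverts H)"
    and arcs: "parcs H = map_prod f f ` parcs K"
  shows "digraph_iso (with_proj K) (with_proj H)"
proof -
  interpret K: pair_wf_digraph K by fact
  \<comment> \<open>\<open>iso_head\<close> and \<open>iso_tail\<close> become the head and tail
    maps of the image graph, so they have to be the projections.\<close>
  let ?h = "\<lparr> iso_verts = f, iso_arcs = map_prod f f, iso_head = snd, iso_tail = fst \<rparr>"
  have inj: "inj_on f (pverts K)" using bij by (simp add: bij_betw_def)
  have "parcs K \<subseteq> pverts K \<times> pverts K" using K.wellformed' by auto
  then have "inj_on (map_prod f f) (parcs K)"
    using map_prod_inj_on[OF inj inj] inj_on_subset by blast
  then have "K.digraph_isomorphism ?h"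
    using inj K.wf_digraph_axioms by (simp add: K.digraph_isomorphism_def)
  moreover have "with_proj H = app_iso ?h (with_proj K)"
    using bij arcs by (simp add: app_iso_def with_proj_def bij_betw_def)
  ultimately show ?thesis unfolding digraph_iso_def by blast
qed

section \<open>Inserting the nodes of a network in the order of their IDs\<close>

text \<open>One edge relation on all IDs encodes a whole insertion sequence: an arc appears once
  both its ends are present.\<close>

definition prefix_network :: "(nat \<times> nat) set \<Rightarrow> nat \<Rightarrow> network" where
  "prefix_network E k = \<lparr> pverts = {1..k}, parcs = E \<inter> {1..k} \<times> {1..k} \<rparr>"

text \<open>The nodes \<open>1, \<dots>, c\<close> are present initially, and node \<open>c + k\<close> arrives in round \<open>k * r\<close>.\<close>

definition incremental_network :: "nat \<Rightarrow> nat \<Rightarrow> nat \<Rightarrow> (nat \<times> nat) set \<Rightarrow> nat \<Rightarrow> network" where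
  "incremental_network n r c E t = prefix_network E (min n (c + t div r))"

lemma pair_graph_prefix_network:
  assumes "sym E" "irrefl E"
  shows "pair_graph (prefix_network E k)"
proof
  show "symmetric (prefix_network E k)"
    using assms(1) by (auto simp: prefix_network_def symmetric_def sym_def)
  show "finite (parcs (prefix_network E k))"
    unfolding prefix_network_def by simp
qed (use assms(2) in \<open>auto simp: prefix_network_def irrefl_def\<close>)

lemma node_insertion_prefix_network:
  assumes "sym E" "irrefl E"
  shows "node_insertion (prefix_network E k) (prefix_network E (Suc k))"
proof -
  let ?S = "{a \<in> {1..k}. (Suc k, a) \<in> E}"
  have "E \<inter> {1..Suc k} \<times> {1..Suc k} = E \<inter> {1..k} \<times> {1..k} \<union> {Suc k} \<times> ?S \<union> ?S \<times> {Suc k}"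
    using assms by (auto simp: le_Suc_eq irrefl_def dest: symD)
  then have "prefix_network E (Suc k) = \<lparr> pverts = insert (Suc k) {1..k},
      parcs = E \<inter> {1..k} \<times> {1..k} \<union> {Suc k} \<times> ?S \<union> ?S \<times> {Suc k} \<rparr>"
    by (simp only: prefix_network_def) (simp add: atLeastAtMostSuc_conv)
  moreover have "Suc k \<notin> {1..k}" "?S \<subseteq> {1..k}" by auto
  ultimately show ?thesis
    unfolding node_insertion_def
    by (intro exI[of _ "Suc k"] exI[of _ ?S])
      (simp only: prefix_network_def pair_pre_digraph.simps simp_thms)
qed

lemma dynamic_network_incremental:
  assumes "sym E" "irrefl E" "r \<ge> 1" "c \<le> n"
  shows "dynamic_network n (incremental_network n r c E)"
proof -
  have "incremental_network n r c E (Suc i) = incremental_network n r c E i \<or>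
      node_insertion (incremental_network n r c E i) (incremental_network n r c E (Suc i))" for i
  proof -
    \<comment> \<open>The quotient grows by one exactly when \<open>r\<close> divides
      \<open>Suc i\<close>; once the cap \<open>n\<close> is reached, nothing changes.\<close>
    have "min n (c + Suc i div r) = min n (c + i div r) \<or>
        min n (c + Suc i div r) = Suc (min n (c + i div r))"
      by (auto simp: div_Suc min_def)
    then show ?thesis
      using node_insertion_prefix_network[OF assms(1,2)]
      by (auto simp: incremental_network_def)
  qed
  moreover have "(\<Union>i. pverts (incremental_network n r c E i)) = {1..n}"
  proof
    have "pverts (incremental_network n r c E (n * r)) = {1..n}"
      using assms(3) by (simp add: incremental_network_def prefix_network_def)
    then show "{1..n} \<subseteq> (\<Union>i. pverts (incremental_network n r c E i))" by blast
  qed (auto simp: incremental_network_def prefix_network_def)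
  ultimately show ?thesis
    unfolding dynamic_network_def
    using pair_graph_prefix_network[OF assms(1,2)] by (simp add: incremental_network_def)
qed

lemma change_at_incremental_dvd:
  assumes "change_at (incremental_network n r c E) i"
  shows "r dvd i"
proof (rule ccontr)
  assume "\<not> r dvd i"
  with assms have "i div r = (i - 1) div r"
    by (cases i) (auto simp: div_Suc change_at_def dvd_eq_mod_eq_0)
  then show False
    using assms by (simp add: change_at_def incremental_network_def)
qed

text \<open>Changes happen only at multiples of \<open>r\<close>, and distinct multiples are at
  least \<open>r\<close> apart.\<close>

lemma change_promise_incremental:
  "change_promise r (incremental_network n r c E)"
  unfolding change_promise_def
proof (intro allI impI)
  fix i j assume i: "change_at (incremental_network n r c E) i" and j: "i < j \<and> j \<le> i + r - 1"
  show "\<not> change_at (incremental_network n r c E) j"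
  proof
    assume "change_at (incremental_network n r c E) j"
    then have "r dvd j - i" using i by (intro dvd_diff_nat change_at_incremental_dvd)
    then have "r \<le> j - i" using j by (intro dvd_imp_le) auto
    with j show False by linarith
  qed
qed

lemma last_node_in_incremental:
  assumes "r \<ge> 1" "c < n"
  shows "n \<in> pverts (incremental_network n r c E t) \<longleftrightarrow> (n - c) * r \<le> t"
proof -
  have "n - c \<le> t div r \<longleftrightarrow> (n - c) * r \<le> t"
    using assms by (simp add: less_eq_div_iff_mult_less_eq)
  then show ?thesis
    using assms by (auto simp: incremental_network_def prefix_network_def)
qed

lemma incremental_network_final:
  assumes "r \<ge> 1" "c < n" "(n - c) * r \<le> t"
  shows "incremental_network n r c E t = prefix_network E n"
proof -
  have "n - c \<le> t div r"
    using assms by (simp add: less_eq_div_iff_mult_less_eq)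
  then show ?thesis by (simp add: incremental_network_def min_def)
qed

lemma change_at_incremental_last:
  assumes "r \<ge> 1" "c < n"
  shows "change_at (incremental_network n r c E) ((n - c) * r)"
proof -
  let ?T = "(n - c) * r"
  have "?T \<ge> 1" using assms by simp
  then have "\<not> ?T \<le> ?T - 1" by linarith
  then have "incremental_network n r c E ?T \<noteq> incremental_network n r c E (?T - 1)"
    using last_node_in_incremental[OF assms, of E ?T]
      last_node_in_incremental[OF assms, of E "?T - 1"] by force
  with \<open>?T \<ge> 1\<close> show ?thesis by (simp add: change_at_def)
qed

text \<open>Node \<open>n\<close> joins in round \<open>(n - c) * r\<close> and must answer
  \<open>r - 1\<close> rounds later, so it makes exactly \<open>r\<close> observations; the graph no
  longer changes meanwhile.\<close>

lemma last_node_history: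
  assumes B: "has_bandwidth A B" and rc: "r \<ge> 1" "c < n"
    and N: "neighbors (prefix_network E n) n = N"
  defines "G \<equiv> incremental_network n r c E"
  shows "run_history A G ((n - c) * r + r - 1) n
      \<in> {hs. set hs \<subseteq> {m. dom m = N \<and> ran m \<subseteq> {l. length l = B}} \<and> length hs = r}"
proof -
  let ?T = "(n - c) * r"
  let ?O = "{m :: observation. dom m = N \<and> ran m \<subseteq> {l. length l = B}}"
  have "?T \<ge> 1" using rc by simp
  have absent: "n \<notin> pverts (G t)" if "t < ?T" for t
    using last_node_in_incremental[OF rc] that by (simp add: G_def)
  have present: "n \<in> pverts (G t)" if "?T \<le> t" for t
    using last_node_in_incremental[OF rc] that by (simp add: G_def)
  have nb: "neighbors (G t) n = N" if "?T \<le> t" for t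
    using incremental_network_final[OF rc that] N by (simp add: G_def)
  \<comment> \<open>Counting starts from the last round without \<open>n\<close>, when its history
    is still empty, so \<open>s\<close> is the number of rounds it has taken part in.\<close>
  have *: "set (run_history A G (?T - 1 + s) n) \<subseteq> ?O \<and> length (run_history A G (?T - 1 + s) n) = s" for s
  proof (induction s)
    case 0
    have "run_history A G t n = []" if "t < ?T" for t
      using absent[OF that] by (cases t) auto
    then have "run_history A G (?T - 1) n = []"
      using \<open>?T \<ge> 1\<close> by (metis diff_less zero_less_one less_le_trans)
    then show ?case by simp
  next
    case (Suc s)
    have le: "?T \<le> Suc (?T - 1 + s)" by linarith
    show ?case
      using Suc B present[OF le] nb[OF le]
      by (auto simp: has_bandwidth_def ran_def dom_def split: if_splits)
  qed
  have "?T + r - 1 = ?T - 1 + r" using \<open>?T \<ge> 1\<close> by simp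
  then show ?thesis using *[of r] by simp
qed

section \<open>Reconstructing the attached candidates\<close>

text \<open>
  The IDs \<open>1, \<dots>, c\<close> form the copy of \<open>H - {u, w}\<close>, the IDs between \<open>c\<close> and \<open>n\<close> are the
  candidates for \<open>w\<close>, and \<open>n\<close> is the node inserted last, in the role of \<open>u\<close>.
\<close>

locale nonadjacent_gadget =
  fixes H :: "'a pair_pre_digraph" and u w :: 'a and g :: "nat \<Rightarrow> 'a" and c n :: nat
  assumes H: "pair_graph H"
    and u: "u \<in> pverts H" and w: "w \<in> pverts H" and uw: "u \<noteq> w" "(u, w) \<notin> parcs H"
    and g: "bij_betw g {1..c} (pverts H - {u, w})"
    and cn: "c < n"
    and arc_ex: "\<And>p. p \<in> pverts H \<Longrightarrow> \<exists>q. (p, q) \<in> parcs H"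
begin

sublocale H: pair_graph H by (fact H)

definition role :: "nat \<Rightarrow> 'a" where
  "role j = (if j \<le> c then g j else if j = n then u else w)"

definition attached :: "nat set \<Rightarrow> nat set" where
  "attached S = {1..c} \<union> S \<union> {n}"

text \<open>The arcs of \<open>H\<close> pulled back along \<open>role\<close>. All candidates share
  the role \<open>w\<close>, so loop-freeness keeps them pairwise non-adjacent; those outside
  \<open>S\<close> stay isolated.\<close>

definition gadget_arcs :: "nat set \<Rightarrow> (nat \<times> nat) set" where
  "gadget_arcs S = {(a, b) \<in> attached S \<times> attached S. (role a, role b) \<in> parcs H}"

lemma H_arc_sym: "(p, q) \<in> parcs H \<Longrightarrow> (q, p) \<in> parcs H"
  using H.pair_sym_arcs by (auto simp: symmetric_def dest: symD)

lemma H_no_loop: "(p, p) \<notin> parcs H"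
  using H.pair_no_loops by force

lemma sym_gadget_arcs: "sym (gadget_arcs S)"
  by (auto simp: sym_def gadget_arcs_def intro: H_arc_sym)

lemma irrefl_gadget_arcs: "irrefl (gadget_arcs S)"
  by (auto simp: irrefl_def gadget_arcs_def H_no_loop)

lemma gadget_network_core:
  assumes "S \<subseteq> {c<..<n}"
  shows "prefix_network (gadget_arcs S) c = prefix_network (gadget_arcs {}) c"
  using assms by (auto simp: prefix_network_def gadget_arcs_def attached_def)

text \<open>The choice of a non-edge pays off here: no candidate is a neighbor of \<open>n\<close>,
  so the neighbor list does not reveal \<open>S\<close>.\<close>

lemma neighbors_last:
  assumes "S \<subseteq> {c<..<n}"
  shows "neighbors (prefix_network (gadget_arcs S) n) n = {b \<in> {1..c}. (u, g b) \<in> parcs H}"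
proof -
  have "(u, u) \<notin> parcs H" by (rule H_no_loop)
  then show ?thesis
    using assms cn uw
    by (auto simp: neighbors_def prefix_network_def gadget_arcs_def attached_def role_def
        split: if_splits)
qed

text \<open>The core, \<open>n\<close> and \<open>i\<close> together form the copy, with
  \<open>role\<close> as the isomorphism.\<close>

lemma mem_list_attached:
  assumes S: "S \<subseteq> {c<..<n}" and i: "i \<in> S"
  shows "\<exists>K \<in> mem_list H (prefix_network (gadget_arcs S) n) n. i \<in> pverts K"
proof -
  define V where "V = insert i (insert n {1..c})"
  define K where "K = \<lparr> pverts = V, parcs = gadget_arcs S \<inter> V \<times> V \<rparr>"
  have i': "c < i" "i < n" using S i by auto
  have wfK: "pair_wf_digraph K"
    by unfold_locales (auto simp: K_def)
  have inj: "inj_on g {1..c}" and img: "g ` {1..c} = pverts H - {u, w}"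
    using g by (auto simp: bij_betw_def)
  have roles: "role i = w" "role n = u" using i' cn by (auto simp: role_def)
  have role_core: "role j = g j" if "j \<in> {1..c}" for j using that by (simp add: role_def)
  have img_core: "role ` {1..c} = pverts H - {u, w}"
    unfolding img[symmetric] by (intro image_cong refl role_core)
  have inj_core: "inj_on role {1..c}"
    using inj inj_on_cong[of "{1..c}" role g] role_core by blast
  have imgV: "role ` V = pverts H"
    unfolding V_def image_insert img_core roles using u w by auto
  have "u \<notin> role ` ({1..c} - {n})" "w \<notin> insert u (role ` {1..c})"
    using img_core uw(1) by auto
  then have injV: "inj_on role V"
    unfolding V_def inj_on_insert image_insert roles
    using inj_core by (auto simp: roles)
  have VS: "V \<subseteq> attached S" using i by (auto simp: V_def attached_def)
  have "parcs H = map_prod role role ` parcs K"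
  proof
    show "parcs H \<subseteq> map_prod role role ` parcs K"
    proof
      fix e assume e: "e \<in> parcs H"
      obtain p q where pq: "e = (p, q)" by (cases e)
      then have "p \<in> role ` V" "q \<in> role ` V" using e H.wellformed' imgV by auto
      then obtain a b where ab: "a \<in> V" "b \<in> V" "p = role a" "q = role b" by auto
      then have "(a, b) \<in> parcs K" using VS e pq by (auto simp: K_def gadget_arcs_def)
      then show "e \<in> map_prod role role ` parcs K" using ab pq by force
    qed
  qed (auto simp: K_def gadget_arcs_def)
  then have "digraph_iso (with_proj K) (with_proj H)"
    using imgV injV by (intro digraph_iso_with_projI[OF wfK]) (auto simp: bij_betw_def K_def)
  moreover have "subgraph (with_proj K) (with_proj (prefix_network (gadget_arcs S) n))"
  proof -
    interpret P: pair_graph "prefix_network (gadget_arcs S) n"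
      by (intro pair_graph_prefix_network sym_gadget_arcs irrefl_gadget_arcs)
    have "V \<subseteq> {1..n}" using i' cn by (auto simp: V_def)
    then show ?thesis
      using wfK P.wf_digraph_axioms
      by (auto simp: subgraph_def compatible_def wf_digraph_wp_iff K_def prefix_network_def)
  qed
  ultimately show ?thesis
    unfolding mem_list_def by (intro bexI[of _ K]) (auto simp: K_def V_def)
qed

text \<open>An unchosen candidate is isolated, whereas every node of a copy of \<open>H\<close> has
  an arc.\<close>

lemma mem_list_unattached:
  assumes "S \<subseteq> {c<..<n}" "i \<in> {c<..<n}" "i \<notin> S"
    and K: "K \<in> mem_list H (prefix_network (gadget_arcs S) n) n"
  shows "i \<notin> pverts K"
proof
  assume "i \<in> pverts K"
  moreover have "digraph_iso (with_proj K) (with_proj H)" using K by (simp add: mem_list_def)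
  ultimately obtain j where "(i, j) \<in> parcs K"
    using digraph_iso_with_proj_arc[of K H i] arc_ex by metis
  then have "(i, j) \<in> gadget_arcs S"
    using K by (auto simp: mem_list_def subgraph_def prefix_network_def)
  then show False using assms(2,3) by (auto simp: gadget_arcs_def attached_def)
qed

text \<open>\<open>S\<close> can be read off as the set of candidates lying in some listed
  copy.\<close>

lemma inj_on_mem_list:
  "inj_on (\<lambda>S. mem_list H (prefix_network (gadget_arcs S) n) n) (Pow {c<..<n})"
proof (rule inj_on_inverseI)
  fix S assume "S \<in> Pow {c<..<n}"
  then show "{i \<in> {c<..<n}. \<exists>K \<in> mem_list H (prefix_network (gadget_arcs S) n) n. i \<in> pverts K} = S"
    using mem_list_attached mem_list_unattached by blast
qed

text \<open>The \<open>2 ^ (n - 1 - c)\<close> choices of \<open>S\<close> force different histories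
  at \<open>n\<close>, of which there are at most \<open>2 ^ (B * c * r)\<close>.\<close>

lemma bandwidth_lower_bound:
  assumes B: "has_bandwidth A B" and A: "solves n r (mem_list H) A" and r: "r \<ge> 1"
  shows "n - 1 - c \<le> B * c * r"
proof -
  define N where "N = {b \<in> {1..c}. (u, g b) \<in> parcs H}"
  define Obs :: "observation set" where "Obs = {m. dom m = N \<and> ran m \<subseteq> {l. length l = B}}"
  let ?M = "{l :: message. length l = B}"
  let ?T = "(n - c) * r"
  let ?G = "\<lambda>S. incremental_network n r c (gadget_arcs S)"
  let ?hist = "\<lambda>S. run_history A (?G S) (?T + r - 1) n"
  let ?L = "{hs. set hs \<subseteq> Obs \<and> length hs = r}"
  have finM: "finite ?M" and cardM: "card ?M = 2 ^ B"
    using finite_lists_length_eq[of "UNIV :: bool set" B] card_lists_length_eq[of "UNIV :: bool set" B]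
    by simp_all
  have "N \<subseteq> {1..c}" by (auto simp: N_def)
  then have finN: "finite N" and cardN: "card N \<le> c"
    using card_mono[of "{1..c}" N] by (auto intro: finite_subset)
  have finO: "finite Obs" and cardO: "card Obs \<le> 2 ^ (B * c)"
  proof -
    show "finite Obs" unfolding Obs_def by (rule card_partial_functions_le(1)[OF finN finM])
    have "card Obs \<le> (2 ^ B) ^ card N"
      using card_partial_functions_le(2)[OF finN finM] by (simp add: Obs_def cardM)
    also have "\<dots> \<le> (2 ^ B) ^ c" using cardN by (intro power_increasing) auto
    finally show "card Obs \<le> 2 ^ (B * c)" by (simp add: power_mult)
  qed
  have hist: "?hist S \<in> ?L" if "S \<in> Pow {c<..<n}" for S
    using last_node_history[OF B r cn, of "gadget_arcs S" N] neighbors_last that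
    by (simp add: Obs_def N_def)
  \<comment> \<open>The ID, the initial graph and the round number are the same for every
    \<open>S\<close>, so the output depends on \<open>S\<close> only through the history.\<close>
  have out: "result A \<lparr> node_id = n, initial_graph = prefix_network (gadget_arcs {}) c,
      round_no = ?T + r - 1, history = ?hist S \<rparr> = mem_list H (prefix_network (gadget_arcs S) n) n"
    if "S \<in> Pow {c<..<n}" for S
  proof -
    have "dynamic_network n (?G S)"
      using sym_gadget_arcs irrefl_gadget_arcs r cn by (intro dynamic_network_incremental) auto
    moreover have "n \<in> pverts (?G S ?T)" using last_node_in_incremental[OF r cn] by simp
    ultimately have "run_result A (?G S) (?T + r - 1) n = mem_list H (?G S ?T) n"
      using A change_promise_incremental change_at_incremental_last[OF r cn]
      unfolding solves_def by blast
    moreover have "?G S 0 = prefix_network (gadget_arcs {}) c"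
      using gadget_network_core[of S] that cn by (simp add: incremental_network_def)
    ultimately show ?thesis
      using incremental_network_final[OF r cn] by (simp add: run_result_def)
  qed
  have "inj_on ?hist (Pow {c<..<n})"
  proof (rule inj_onI)
    fix S S' assume S: "S \<in> Pow {c<..<n}" "S' \<in> Pow {c<..<n}" and eq: "?hist S = ?hist S'"
    show "S = S'"
      using out[OF S(1)] out[OF S(2)] unfolding eq by (intro inj_onD[OF inj_on_mem_list _ S]) simp
  qed
  then have "card (Pow {c<..<n}) \<le> card ?L"
    using hist by (intro card_inj_on_le[of ?hist] finite_lists_length_eq finO) auto
  also have "card ?L = card Obs ^ r" using finO by (rule card_lists_length_eq)
  also have "\<dots> \<le> (2 ^ (B * c)) ^ r" using cardO by (intro power_mono) auto
  finally have "(2::nat) ^ (n - 1 - c) \<le> 2 ^ (B * c * r)"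
    by (simp add: card_Pow power_mult)
  then show ?thesis by (rule power_le_imp_le_exp[rotated]) simp
qed

end

section \<open>From the bit count to the asymptotic bound\<close>

theorem theorem5p8:
  fixes H :: "'a pair_pre_digraph"
  assumes "pair_graph H"
    and "Digraph_Component.connected (with_proj H)"
    and "card (pverts H) \<ge> 3"
    and "\<not> complete_digraph (card (pverts H)) (with_proj H)"
  shows "\<exists>c::real. c > 0 \<and> (\<exists>N::nat. \<forall>n\<ge>N. \<forall>r::nat. r \<ge> 1 \<longrightarrow>
           ereal (c * real n / real r) \<le> ereal_of_enat (bandwidth_complexity n r (mem_list H)))"
proof -
  interpret H: pair_graph H by fact
  have arc_ex: "\<exists>q. (p, q) \<in> parcs H" if "p \<in> pverts H" for p
    using pair_graph_connected_imp_arc[OF assms(1,2) _ that] assms(3) by simp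
  have "parcs H \<subseteq> {(u, v). (u, v) \<in> pverts H \<times> pverts H \<and> u \<noteq> v}"
    using H.wellformed' H.pair_no_loops by fastforce
  moreover have "parcs H \<noteq> {(u, v). (u, v) \<in> pverts H \<times> pverts H \<and> u \<noteq> v}"
    using assms(4) H.pair_finite_verts by (simp add: complete_digraph_pair_def)
  ultimately obtain u w where uw: "u \<in> pverts H" "w \<in> pverts H" "u \<noteq> w" "(u, w) \<notin> parcs H"
    by auto
  define c where "c = card (pverts H - {u, w})"
  have c: "c \<ge> 1"
    using assms(3) uw by (simp add: c_def card_Diff_subset)
  obtain g where g: "bij_betw g {1..c} (pverts H - {u, w})"
    unfolding c_def using ex_bij_betw_nat_finite_1[of "pverts H - {u, w}"] H.pair_finite_verts by auto
  \<comment> \<open>The threshold on \<open>n\<close> makes \<open>n - 1 - c\<close> at least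
    \<open>n / 2\<close>, whence the factor 2 in the constant; the factor \<open>c\<close> bounds
    the number of neighbors of the last node.\<close>
  have lower: "ereal (1 / (2 * real c) * real n / real r)
      \<le> ereal_of_enat (bandwidth_complexity n r (mem_list H))"
    if n: "n \<ge> 2 * (c + 1)" and r: "r \<ge> 1" for n r
  proof -
    interpret nonadjacent_gadget H u w g c n
      using assms(1) uw g n arc_ex by unfold_locales auto
    let ?x = "1 / (2 * real c) * real n / real r"
    \<comment> \<open>The complexity is an extended natural number, so the real bound is first
      rounded up. An infimum over no bandwidths is infinite and is covered as well.\<close>
    have "enat (nat \<lceil>?x\<rceil>) \<le> bandwidth_complexity n r (mem_list H)"
      unfolding bandwidth_complexity_def
    proof (rule INF_greatest)
      fix B assume "B \<in> {B. \<exists>A. has_bandwidth A B \<and> solves n r (mem_list H) A}"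
      then have "n - 1 - c \<le> B * c * r" using bandwidth_lower_bound r by blast
      then have "2 * (n - 1 - c) \<le> 2 * (B * c * r)" by (rule mult_le_mono2)
      moreover have "n \<le> 2 * (n - 1 - c)" using n by arith
      ultimately have "n \<le> 2 * (B * c * r)" by (rule order_trans[rotated])
      then have "real n \<le> real (2 * (B * c * r))" by (rule of_nat_mono)
      then have "?x \<le> real B" using c r by (simp add: field_simps)
      then show "enat (nat \<lceil>?x\<rceil>) \<le> enat B" by (simp add: ceiling_le_iff)
    qed
    then have "ereal_of_enat (enat (nat \<lceil>?x\<rceil>)) \<le> ereal_of_enat (bandwidth_complexity n r (mem_list H))"
      by (simp only: ereal_of_enat_le_iff)
    moreover have "ereal ?x \<le> ereal_of_enat (enat (nat \<lceil>?x\<rceil>))"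
      using real_nat_ceiling_ge[of ?x] by (simp only: ereal_of_enat_simps ereal_less_eq)
    ultimately show ?thesis by (rule order_trans[rotated])
  qed
  show ?thesis
    using c lower by (intro exI[of _ "1 / (2 * real c)"]) auto
qed

end
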